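(* Let $n\ge 2$ and $m\ge 0$ be integers, and let $\alpha_0=\alpha_1=\beta_0=0$ and $\alpha_2\neq 0$. Let $s$ be a non-zero root of the indicial equation $s(s-1)+(\beta_1/\alpha_2)s-\tau_0/\alpha_2=0$, so $$s\in\left\{\frac{\alpha_2-\beta_1\pm\sqrt{(\alpha_2-\beta_1)^2+4\alpha_2\tau_0}}{2\alpha_2}\right\}.$$ The second-order linear differential equation $$\Big(\sum_{k=2}^{n}\alpha_k r^k\Big)y''(r)+\Big(\sum_{k=1}^{n-1}\beta_k r^k\Big)y'(r)-\Big(\sum_{k=0}^{n-2}\tau_k r^k\Big)y(r)=0$$ admits the solution $y(r)=r^{s}\mathcal{P}_m(r)=r^{s}\sum_{i=0}^{m}\mathcal{C}_i r^i$ in the neighbourhood of the regular singular point $r=0$, where $\mathcal{P}_m$ is a polynomial of degree $m$, if $$\sum_{j=0}^{n-2}\Big[\alpha_{n-j}(\ell-n+j+s+2)(\ell-n+j+s+1)+\beta_{n-j-1}(\ell-n+j+s+2)-\tau_{n-j-2}\Big]\,\mathcal{C}_{\ell-n+j+2}=0$$ for all $\ell=0,1,2,\ldots,m+n-2$.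
   Context: The coefficients $\alpha_k,\beta_k,\tau_k$ and $\mathcal{C}_i$ are constants (real or complex numbers). Conventions: $\mathcal{C}_i=0$ if $i<0$ or $i>m$; and $\mathcal{C}_m\neq 0$ since $\mathcal{P}_m$ has degree $m$. When $s$ is not a nonnegative integer, $r^s$ denotes the usual power function (e.g. for $r>0$), and the solution is understood away from $r=0$. *)

theory Defs
  imports "HOL-Analysis.Analysis"
begin

(* The equation a(r) y'' + b(r) y' - c(r) y = 0, with the sign convention of the last term.
   It is only used on open sets S, where the iterated deriv is the genuine second derivative.
   Restricting a solution to the positive real axis gives a solution of the real-variable
   equation. *)
definition solves_linear_ode2_on ::
  "(complex \<Rightarrow> complex) \<Rightarrow> (complex \<Rightarrow> complex) \<Rightarrow> (complex \<Rightarrow> complex) \<Rightarrow>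
    complex set \<Rightarrow> (complex \<Rightarrow> complex) \<Rightarrow> bool" where
  "solves_linear_ode2_on a b c S y \<longleftrightarrow>
    (\<forall>r\<in>S. y field_differentiable (at r) \<and> deriv y field_differentiable (at r) \<and>
      a r * deriv (deriv y) r + b r * deriv y r - c r * y r = 0)"

(* Where the principal branch r powr s is holomorphic, for s nonzero.  The case s = 0 is to be
   avoided: the library sets 0 powr s = 0, which is the value of r^s at r = 0 only for
   positive integers s. *)
definition power_domain :: "complex \<Rightarrow> complex set" where
  "power_domain s =
    (if s \<in> \<nat> then UNIV else if s \<in> \<int> then - {0} else - \<real>\<^sub>\<le>\<^sub>0)"

end

theory Submission
  imports Defs "HOL-Complex_Analysis.Complex_Analysis"
begin

text \<open>
  This is the method of Frobenius for a series that terminates. Away from the origin the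
  candidate solution is the finite sum of the terms \<open>C i * r powr (s + i)\<close>, and on the rest of
  \<open>power_domain s\<close> these powers obey the usual rules: differentiating lowers the exponent by
  one and brings it down as a factor, and multiplying by \<open>r ^ k\<close> raises it by \<open>k\<close>. The operator of
  the equation therefore turns the term with index \<open>i\<close> into a combination of the powers
  \<open>r powr (s + l)\<close>, where \<open>l = i + k - 2\<close> and \<open>k\<close> runs over \<open>{2..n}\<close>. This is why the
  coefficients are grouped as \<open>\<alpha> k\<close>, \<open>\<beta> (k - 1)\<close>, \<open>\<tau> (k - 2)\<close>: together with the
  derivatives that they multiply, the three of them shift the exponent by the same amount.
  Collecting the terms with a fixed \<open>l\<close> (\<open>sum_powr_collect_exponents\<close>) yields exactly the \<open>l\<close>-th recurrence relation as the coefficient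
  of \<open>r powr (s + l)\<close>, so that the left-hand side of the equation vanishes.

  The origin belongs to the domain only if \<open>s\<close> is a natural number. There the candidate is a
  polynomial without constant term, since \<open>s \<noteq> 0\<close>; it is infinitely often
  differentiable, and at \<open>r = 0\<close> all three summands of the equation are zero. As the solution is a
  finite sum, the neighbourhood of the origin can be taken to be the whole plane.
\<close>

lemma open_power_domain: "open (power_domain s)"
  by (auto simp: power_domain_def open_Compl)

text \<open>
  For natural \<open>s\<close> the origin is included; this is where \<open>s \<noteq> 0\<close> matters, because
  \<open>0 powr 0 = 0\<close> makes the power with exponent zero discontinuous at the origin.
\<close>
lemma holomorphic_on_powr_power_domain:
  assumes "s \<noteq> 0"
  shows "(\<lambda>r. r powr s) holomorphic_on power_domain s"
proof -
  consider p where "s = of_nat p" | k where "s = of_int k" "s \<notin> \<nat>" | "s \<notin> \<nat>" "s \<notin> \<int>"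
    by (auto elim!: Nats_cases Ints_cases)
  then show ?thesis
  proof cases
    case 1
    with assms have "(\<lambda>r. r powr s) = (\<lambda>r. r ^ p)"
      by (auto simp: powr_nat')
    then show ?thesis
      by (auto intro!: holomorphic_intros)
  next
    case 2
    then show ?thesis
      by (auto simp: power_domain_def intro!: holomorphic_intros)
  next
    case 3
    then show ?thesis
      by (auto simp: power_domain_def intro!: holomorphic_intros)
  qed
qed

text \<open>
  Away from the origin the domain does not change if the exponent is shifted by an integer, so a
  single set serves for all the powers that occur in a Frobenius sum and in its derivatives.
\<close>
lemma has_field_derivative_powr_shifted:
  assumes "r \<in> power_domain s" "r \<noteq> 0"
  shows "((\<lambda>z. z powr (s + of_int i)) has_field_derivative
           (s + of_int i) * r powr (s + of_int (i - 1))) (at r)"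
proof (cases "s \<in> \<int>")
  case True
  then obtain k where k: "s = of_int k"
    by (auto elim: Ints_cases)
  show ?thesis
    using has_field_derivative_powr_of_int[of "\<lambda>z. z" 1 r UNIV "k + i"] assms(2)
    by (simp add: k algebra_simps)
next
  case False
  moreover have "s \<notin> \<nat>"
    using False Nats_subset_Ints by blast
  ultimately have "r \<notin> \<real>\<^sub>\<le>\<^sub>0"
    using assms(1) by (simp add: power_domain_def)
  then show ?thesis
    using has_field_derivative_powr[of r "s + of_int i"] by (simp add: algebra_simps)
qed

lemma powr_shift_mult_power:
  fixes r s :: complex
  assumes "r \<noteq> 0"
  shows "r ^ k * r powr (s + of_int i) = r powr (s + of_int (i + int k))"
proof -
  have "r ^ k = r powr of_nat k"
    using assms by (simp add: powr_nat)
  then show ?thesis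
    by (simp add: powr_add mult_ac)
qed

text \<open>
  Termwise differentiation of a Frobenius sum. The coefficients are arbitrary, so that the rule
  also applies to the derivative that it produces, where \<open>d\<close> is lowered by one.
\<close>
lemma deriv_sum_powr:
  assumes "r \<in> power_domain s" "r \<noteq> 0"
  shows "deriv (\<lambda>z. \<Sum>i\<in>I. c i * z powr (s + of_int (int i + d))) r =
           (\<Sum>i\<in>I. c i * (s + of_int (int i + d)) * r powr (s + of_int (int i + (d - 1))))"
proof (rule DERIV_imp_deriv)
  have "((\<lambda>z. c i * z powr (s + of_int (int i + d))) has_field_derivative
          c i * (s + of_int (int i + d)) * r powr (s + of_int (int i + (d - 1)))) (at r)" for i
    using DERIV_cmult[OF has_field_derivative_powr_shifted[OF assms, of "int i + d"], of "c i"]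
    by (simp only: mult.assoc add_diff_eq)
  then show "((\<lambda>z. \<Sum>i\<in>I. c i * z powr (s + of_int (int i + d))) has_field_derivative
      (\<Sum>i\<in>I. c i * (s + of_int (int i + d)) * r powr (s + of_int (int i + (d - 1))))) (at r)"
    by (intro DERIV_sum) auto
qed

text \<open>
  Collecting equal exponents \<open>l = i + k - 2\<close>. For fixed \<open>k\<close> the index \<open>l\<close> only fills the window
  \<open>{k - 2..m + k - 2}\<close>; it may run over the common range \<open>{0..m + n - 2}\<close> because the
  coefficients \<open>C\<close> vanish outside \<open>{0..m}\<close>. The substitution \<open>k = n - j\<close> turns the
  inner sum into the indexing of the recurrence relation.
\<close>
lemma sum_powr_collect_exponents:
  fixes C :: "int \<Rightarrow> 'a::comm_semiring_0" and T :: "int \<Rightarrow> nat \<Rightarrow> 'a" and E :: "int \<Rightarrow> 'a"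
  assumes n: "n \<ge> 2" and C: "\<And>i. i < 0 \<or> i > int m \<Longrightarrow> C i = 0"
  shows "(\<Sum>k=2..n. \<Sum>i=0..m. T (int i) k * C (int i) * E (int i + int k - 2)) =
    (\<Sum>l=0..m + n - 2. (\<Sum>j=0..n - 2. T (int l - int n + int j + 2) (n - j)
        * C (int l - int n + int j + 2)) * E (int l))"
proof -
  have window: "(\<Sum>i=0..m. T (int i) k * C (int i) * E (int i + int k - 2)) =
      (\<Sum>l=0..m + n - 2. T (int l - int k + 2) k * C (int l - int k + 2) * E (int l))"
    if k: "k \<in> {2..n}" for k
  proof (rule sum.reindex_bij_witness_not_neutral
      [where S' = "{}" and T' = "{l \<in> {0..m + n - 2}. l + 2 < k \<or> l + 2 > m + k}"
         and j = "\<lambda>i. i + k - 2" and i = "\<lambda>l. l + 2 - k"])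
    fix l assume "l \<in> {l \<in> {0..m + n - 2}. l + 2 < k \<or> l + 2 > m + k}"
    then have "int l - int k + 2 < 0 \<or> int l - int k + 2 > int m"
      by auto
    then show "T (int l - int k + 2) k * C (int l - int k + 2) * E (int l) = 0"
      using C by simp
  qed (use k in \<open>auto simp: of_nat_diff\<close>)
  have reverse: "(\<Sum>k=2..n. T (int l - int k + 2) k * C (int l - int k + 2)) =
      (\<Sum>j=0..n - 2. T (int l - int n + int j + 2) (n - j) * C (int l - int n + int j + 2))" for l
    by (rule sum.reindex_bij_witness[where i = "\<lambda>j. n - j" and j = "\<lambda>k. n - k"])
       (use n in \<open>auto simp: of_nat_diff algebra_simps\<close>)
  have "(\<Sum>k=2..n. \<Sum>i=0..m. T (int i) k * C (int i) * E (int i + int k - 2)) =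
      (\<Sum>k=2..n. \<Sum>l=0..m + n - 2. T (int l - int k + 2) k * C (int l - int k + 2) * E (int l))"
    by (rule sum.cong[OF refl window])
  also have "\<dots> = (\<Sum>l=0..m + n - 2. (\<Sum>k=2..n.
      T (int l - int k + 2) k * C (int l - int k + 2)) * E (int l))"
    by (subst sum.swap) (simp add: sum_distrib_right)
  finally show ?thesis
    by (simp only: reverse)
qed

theorem theorem4p3:
  fixes n m :: nat
    and \<alpha> \<beta> \<tau> :: "nat \<Rightarrow> complex"
    and s :: complex
    and C :: "int \<Rightarrow> complex"
  assumes "n \<ge> 2"
    and "\<alpha> 0 = 0" and "\<alpha> 1 = 0" and "\<beta> 0 = 0" and "\<alpha> 2 \<noteq> 0"
    and "s \<noteq> 0"
    and "s * (s - 1) + (\<beta> 1 / \<alpha> 2) * s - \<tau> 0 / \<alpha> 2 = 0"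
    and "\<And>i. i < 0 \<or> i > int m \<Longrightarrow> C i = 0"
    and "C (int m) \<noteq> 0"
    and "\<And>l. l \<in> {0..m + n - 2} \<Longrightarrow>
      (\<Sum>j = 0..n - 2.
        (\<alpha> (n - j) * (of_int (int l - int n + int j) + s + 2) * (of_int (int l - int n + int j) + s + 1)
          + \<beta> (n - j - 1) * (of_int (int l - int n + int j) + s + 2)
          - \<tau> (n - j - 2)) * C (int l - int n + int j + 2)) = 0"
  shows "\<exists>U. open U \<and> 0 \<in> U \<and>
    solves_linear_ode2_on
      (\<lambda>r. \<Sum>k = 2..n. \<alpha> k * r ^ k)
      (\<lambda>r. \<Sum>k = 1..n - 1. \<beta> k * r ^ k)
      (\<lambda>r. \<Sum>k = 0..n - 2. \<tau> k * r ^ k)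
      (U \<inter> power_domain s)
      (\<lambda>r. r powr s * (\<Sum>i = 0..m. C (int i) * r ^ i))"
proof (intro exI conjI)
  let ?y = "\<lambda>r. r powr s * (\<Sum>i = 0..m. C (int i) * r ^ i)"
  let ?a = "\<lambda>r. \<Sum>k = 2..n. \<alpha> k * r ^ k"
  let ?b = "\<lambda>r. \<Sum>k = 1..n - 1. \<beta> k * r ^ k"
  let ?c = "\<lambda>r. \<Sum>k = 0..n - 2. \<tau> k * r ^ k"
  note n = \<open>n \<ge> 2\<close>
  have y_hol: "?y holomorphic_on power_domain s"
    by (intro holomorphic_on_mult holomorphic_on_powr_power_domain[OF \<open>s \<noteq> 0\<close>])
       (intro holomorphic_intros)
  have dy_hol: "deriv ?y holomorphic_on power_domain s"
    using y_hol open_power_domain by (rule holomorphic_deriv)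
  have ode: "?a r * deriv (deriv ?y) r + ?b r * deriv ?y r - ?c r * ?y r = 0"
    if r: "r \<in> power_domain s" for r
  proof (cases "r = 0")
    case True
    then have "?a r = 0" "?b r = 0" "?y r = 0"
      by (auto intro!: sum.neutral)
    then show ?thesis
      by simp
  next
    case False
    define e where "e z l = z powr (s + of_int l)" for z l
    define S where "S = power_domain s - {0}"
    have S: "open S" "r \<in> S"
      using r False open_power_domain[of s] by (auto simp: S_def)
    have y: "?y z = (\<Sum>i=0..m. C (int i) * z powr (s + of_int (int i + 0)))" if "z \<in> S" for z
      unfolding sum_distrib_left
    proof (intro sum.cong refl)
      fix i
      have "z powr s * z ^ i = z powr (s + of_int (int i))"
        using powr_shift_mult_power[of z i s 0] that by (simp add: S_def mult.commute)
      then show "z powr s * (C (int i) * z ^ i) = C (int i) * z powr (s + of_int (int i + 0))"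
        by (simp add: mult_ac)
    qed
    have dy: "deriv ?y z =
        (\<Sum>i=0..m. C (int i) * (s + of_int (int i)) * z powr (s + of_int (int i + (-1))))"
      if "z \<in> S" for z
    proof -
      have "deriv ?y z = deriv (\<lambda>z. \<Sum>i=0..m. C (int i) * z powr (s + of_int (int i + 0))) z"
        using eventually_nhds_in_open[OF S(1) that]
        by (intro deriv_cong_ev refl) (auto elim!: eventually_mono simp: y)
      also have "\<dots> = (\<Sum>i=0..m. C (int i) * (s + of_int (int i)) *
          z powr (s + of_int (int i + (-1))))"
        using deriv_sum_powr[of z s "\<lambda>i. C (int i)" 0 "{0..m}"] that by (simp add: S_def)
      finally show ?thesis .
    qed
    have "deriv (deriv ?y) r = deriv (\<lambda>z. \<Sum>i=0..m. C (int i) * (s + of_int (int i)) *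
        z powr (s + of_int (int i + (-1)))) r"
      using eventually_nhds_in_open[OF S]
      by (intro deriv_cong_ev refl) (auto elim!: eventually_mono simp: dy)
    also have "\<dots> = (\<Sum>i=0..m. C (int i) * (s + of_int (int i)) * (s + of_int (int i + (-1))) *
        r powr (s + of_int (int i + (-1 - 1))))"
      using S(2) by (intro deriv_sum_powr) (auto simp: S_def)
    finally have ddy: "deriv (deriv ?y) r =
        (\<Sum>i=0..m. C (int i) * (s + of_int (int i)) * (s + of_int (int i) - 1) *
           e r (int i - 2))"
      by (simp add: e_def algebra_simps)
    have dy': "deriv ?y r = (\<Sum>i=0..m. C (int i) * (s + of_int (int i)) * e r (int i - 1))"
      using dy[OF S(2)] by (simp add: e_def)
    have y': "?y r = (\<Sum>i=0..m. C (int i) * e r (int i))"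
      using y[OF S(2)] by (simp add: e_def)
    have shift: "r ^ k * e r l = e r (l + int k)" for k l
      using False by (simp add: e_def powr_shift_mult_power)
    \<comment> \<open>The three coefficient polynomials are indexed so that each of them, applied to its
      derivative of the candidate, moves the exponent of the \<open>i\<close>-th term to \<open>s + i + k - 2\<close>.\<close>
    have A: "?a r * deriv (deriv ?y) r = (\<Sum>k=2..n. \<Sum>i=0..m.
        \<alpha> k * (s + of_int (int i)) * (s + of_int (int i) - 1) * C (int i) * e r (int i + int k - 2))"
      unfolding ddy sum_product
    proof (intro sum.cong refl)
      fix k i
      have exponent: "r ^ k * e r (int i - 2) = e r (int i + int k - 2)"
        using shift[of k "int i - 2"] by (simp add: algebra_simps)
      show "\<alpha> k * r ^ k * (C (int i) * (s + of_int (int i)) * (s + of_int (int i) - 1) *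
          e r (int i - 2)) = \<alpha> k * (s + of_int (int i)) * (s + of_int (int i) - 1) * C (int i) *
          e r (int i + int k - 2)"
        by (simp only: mult_ac flip: exponent)
    qed
    have b': "?b r = (\<Sum>k=2..n. \<beta> (k - 1) * r ^ (k - 1))"
      by (rule sum.reindex_bij_witness[where i = "\<lambda>k. k - 1" and j = "\<lambda>k. k + 1"]) (use n in auto)
    have B: "?b r * deriv ?y r = (\<Sum>k=2..n. \<Sum>i=0..m.
        \<beta> (k - 1) * (s + of_int (int i)) * C (int i) * e r (int i + int k - 2))"
      unfolding b' dy' sum_product
    proof (intro sum.cong refl)
      fix k i assume "k \<in> {2..n}"
      then have exponent: "r ^ (k - 1) * e r (int i - 1) = e r (int i + int k - 2)"
        using shift[of "k - 1" "int i - 1"] by (simp add: of_nat_diff algebra_simps)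
      show "\<beta> (k - 1) * r ^ (k - 1) * (C (int i) * (s + of_int (int i)) * e r (int i - 1)) =
          \<beta> (k - 1) * (s + of_int (int i)) * C (int i) * e r (int i + int k - 2)"
        by (simp only: mult_ac flip: exponent)
    qed
    have c': "?c r = (\<Sum>k=2..n. \<tau> (k - 2) * r ^ (k - 2))"
      by (rule sum.reindex_bij_witness[where i = "\<lambda>k. k - 2" and j = "\<lambda>k. k + 2"]) (use n in auto)
    have G: "?c r * ?y r = (\<Sum>k=2..n. \<Sum>i=0..m.
        \<tau> (k - 2) * C (int i) * e r (int i + int k - 2))"
      unfolding c' y' sum_product
    proof (intro sum.cong refl)
      fix k i assume "k \<in> {2..n}"
      then have exponent: "r ^ (k - 2) * e r (int i) = e r (int i + int k - 2)"
        using shift[of "k - 2" "int i"] by (simp add: of_nat_diff algebra_simps)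
      show "\<tau> (k - 2) * r ^ (k - 2) * (C (int i) * e r (int i)) =
          \<tau> (k - 2) * C (int i) * e r (int i + int k - 2)"
        by (simp only: mult_ac flip: exponent)
    qed
    define T where "T i k = \<alpha> k * (s + of_int i) * (s + of_int i - 1)
        + \<beta> (k - 1) * (s + of_int i) - \<tau> (k - 2)" for i :: int and k
    have "?a r * deriv (deriv ?y) r + ?b r * deriv ?y r - ?c r * ?y r =
        (\<Sum>k=2..n. \<Sum>i=0..m. T (int i) k * C (int i) * e r (int i + int k - 2))"
      unfolding A B G by (simp only: T_def distrib_right left_diff_distrib sum.distrib sum_subtractf)
    also have "\<dots> = (\<Sum>l=0..m + n - 2. (\<Sum>j=0..n - 2. T (int l - int n + int j + 2) (n - j)
        * C (int l - int n + int j + 2)) * e r (int l))"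
      by (rule sum_powr_collect_exponents[OF n assms(8)])
    also have "\<dots> = 0"
    proof (intro sum.neutral ballI)
      fix l assume l: "l \<in> {0..m + n - 2}"
      have "T (int l - int n + int j + 2) (n - j) =
          \<alpha> (n - j) * (of_int (int l - int n + int j) + s + 2) *
            (of_int (int l - int n + int j) + s + 1)
          + \<beta> (n - j - 1) * (of_int (int l - int n + int j) + s + 2) - \<tau> (n - j - 2)" for j
      proof -
        have "s + of_int (int l - int n + int j + 2) = of_int (int l - int n + int j) + s + 2"
          "s + of_int (int l - int n + int j + 2) - 1 = of_int (int l - int n + int j) + s + 1"
          by simp_all
        then show ?thesis
          unfolding T_def by (simp only:)
      qed
      then show "(\<Sum>j=0..n - 2. T (int l - int n + int j + 2) (n - j)
        * C (int l - int n + int j + 2)) * e r (int l) = 0"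
        using assms(10)[OF l] by simp
    qed
    finally show ?thesis .
  qed
  show "solves_linear_ode2_on ?a ?b ?c (UNIV \<inter> power_domain s) ?y"
    unfolding solves_linear_ode2_on_def
    using ode y_hol dy_hol open_power_domain[of s]
    by (auto simp: holomorphic_on_open field_differentiable_def)
qed auto

end
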